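(* Let $X$ be a transient random walk on $\mathbf{Z}^d$ started at $X_0=0$, with Green function $g$. Then, with probability one, $$\overline{\mathrm{Dim}}_{\mathrm M}(\mathcal{R}_X)=\gamma_c:=\inf\Big\{\gamma\in(0,d):\ \sum_{x\in\mathbf{Z}^d\setminus\{0\}}\frac{g(0,x)}{\|x\|^\gamma}<\infty\Big\},$$ with the convention $\inf\varnothing:=d$.
   Context: A random walk on $\mathbf{Z}^d$ is $X_n=X_0+\xi_1+\cdots+\xi_n$ with $\xi_1,\xi_2,\dots$ i.i.d. $\mathbf{Z}^d$-valued; $P^a$ denotes its law when $X_0=a$. Its Green function is $g(a,x):=\sum_{n\ge0}P^a\{X_n=x\}$, and transience means $g$ is finite. $\mathcal{R}_X:=\bigcup_{n\ge0}\{X_n\}$ is the range. For $k\ge0$, $\mathcal{V}_k:=[-2^k,2^k)^d$. The macroscopic upper Minkowski dimension of $A\subseteq\mathbf{Z}^d$ is $\overline{\mathrm{Dim}}_{\mathrm M}(A):=\limsup_{n\to\infty}n^{-1}\log_2\#(A\cap\mathcal{V}_n)$. $\|\cdot\|$ is the Euclidean norm. *)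

theory Defs
  imports "HOL-Probability.Probability"
begin

text \<open>Points of Z^d are int vectors indexed by a finite type 'd; d = CARD('d).\<close>

definition eucl_norm :: "int ^ 'd \<Rightarrow> real" where
  "eucl_norm x = sqrt (\<Sum>i\<in>UNIV. (real_of_int (x $ i))^2)"

text \<open>The random walk started at 0: X_n = xi_1 + ... + xi_n (steps indexed from 0 here).\<close>
definition walk :: "(nat \<Rightarrow> 'w \<Rightarrow> int ^ 'd) \<Rightarrow> nat \<Rightarrow> 'w \<Rightarrow> int ^ 'd" where
  "walk \<xi> n \<omega> = (\<Sum>i<n. \<xi> i \<omega>)"

definition green0 :: "'w measure \<Rightarrow> (nat \<Rightarrow> 'w \<Rightarrow> int ^ 'd) \<Rightarrow> int ^ 'd \<Rightarrow> ennreal" where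
  "green0 M \<xi> x = (\<Sum>n. emeasure M {\<omega> \<in> space M. walk \<xi> n \<omega> = x})"

definition range_walk :: "(nat \<Rightarrow> 'w \<Rightarrow> int ^ 'd) \<Rightarrow> 'w \<Rightarrow> (int ^ 'd) set" where
  "range_walk \<xi> \<omega> = (\<Union>n. {walk \<xi> n \<omega>})"

definition cubeV :: "nat \<Rightarrow> (int ^ 'd) set" where
  "cubeV k = {x. \<forall>i. - (2 ^ k) \<le> x $ i \<and> x $ i < 2 ^ k}"

definition upper_mink_dim :: "(int ^ 'd) set \<Rightarrow> ereal" where
  "upper_mink_dim A = limsup (\<lambda>n. ereal (log 2 (real (card (A \<inter> cubeV n))) / real n))"

definition gamma_c :: "'w measure \<Rightarrow> (nat \<Rightarrow> 'w \<Rightarrow> int ^ 'd) \<Rightarrow> real" where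
  "gamma_c M \<xi> =
    (let S = {\<gamma>::real. 0 < \<gamma> \<and> \<gamma> < real CARD('d) \<and>
               (\<integral>\<^sup>+ x. green0 M \<xi> x / ennreal (eucl_norm x powr \<gamma>)
                   \<partial>count_space (UNIV - {0})) < \<top>}
     in if S = {} then real CARD('d) else Inf S)"

end

theory Submission
  imports Defs
begin

text \<open>
  Let \<open>G n\<close> be the sum of the Green function over the cube \<open>V n\<close>, and let \<open>N n\<close> be the number of
  points of the range in \<open>V n\<close>. Decomposing the defining series over dyadic cubes shows that \<open>\<gamma>_c\<close>
  is the exponential growth rate of \<open>G n\<close>. Since \<open>E (N n) \<le> G n\<close>, Markov's inequality and the
  Borel-Cantelli lemma bound the growth rate of \<open>N n\<close> from above by that of \<open>G n\<close>. Conversely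
  \<open>E (N n) \<ge> G n / g 0\<close>, because a point is hit with probability \<open>g x / g 0\<close>, and
  \<open>E ((N n)\<^sup>2) \<le> 2 * G n * G (n + 1)\<close> by the Markov property. A first entrance decomposition gives
  \<open>G (n + 1) \<le> 4 ^ d * G n\<close>, so by the Paley-Zygmund inequality \<open>N n \<ge> G n / (2 * g 0)\<close> with
  probability bounded below uniformly in \<open>n\<close>. Hence the lower bound on the dimension holds with
  positive probability, and with probability one by Kolmogorov's zero-one law.
\<close>

subsection \<open>Cubes\<close>

lemma bij_betw_vec_lambda_PiE:
  "bij_betw vec_lambda (PiE (UNIV :: 'd set) (\<lambda>_. A)) {x :: 'a ^ 'd. \<forall>i. x $ i \<in> A}"
  by (rule bij_betwI[where g = vec_nth]) auto

lemma cubeV_altdef: "cubeV n = {x. \<forall>i. x $ i \<in> {- (2 ^ n)..<2 ^ n}}"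
  by (auto simp: cubeV_def)

lemma finite_cubeV [simp]: "finite (cubeV n)"
  unfolding cubeV_altdef bij_betw_finite[OF bij_betw_vec_lambda_PiE, symmetric]
  by (intro finite_PiE) auto

lemma card_cubeV: "card (cubeV n :: (int ^ 'd) set) = (2 * 2 ^ n) ^ CARD('d)"
  unfolding cubeV_altdef bij_betw_same_card[OF bij_betw_vec_lambda_PiE, symmetric]
  by (simp add: card_PiE nat_mult_distrib nat_power_eq)

lemma zero_in_cubeV [simp]: "0 \<in> cubeV n"
  by (simp add: cubeV_def)

lemma cubeV_diff: "x \<in> cubeV n \<Longrightarrow> y \<in> cubeV n \<Longrightarrow> x - y \<in> cubeV (Suc n)"
  unfolding cubeV_def by simp (smt (verit))

lemma cubeV_mono:
  assumes "m \<le> n"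
  shows "cubeV m \<subseteq> cubeV n"
proof -
  have "(2 :: int) ^ m \<le> 2 ^ n" using assms by (simp add: power_increasing)
  then show ?thesis unfolding cubeV_def by (smt (verit) Collect_mono)
qed

lemma eventually_in_cubeV: "\<forall>\<^sub>F n in sequentially. x \<in> cubeV n"
proof -
  define s where "s = (\<Sum>i\<in>UNIV. nat \<bar>x $ i\<bar>)"
  have "x \<in> cubeV s"
    unfolding cubeV_def
  proof safe
    fix i
    have "nat \<bar>x $ i\<bar> \<le> s" unfolding s_def by (rule member_le_sum) auto
    moreover have "s < 2 ^ s" by simp
    ultimately have "int (nat \<bar>x $ i\<bar>) < int (2 ^ s)" by linarith
    then have "\<bar>x $ i\<bar> < 2 ^ s" by simp
    then show "- (2 ^ s) \<le> x $ i" "x $ i < 2 ^ s" by linarith+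
  qed
  then show ?thesis
    using cubeV_mono by (auto simp: eventually_sequentially intro!: exI[of _ s])
qed

definition dyadic_box :: "nat \<Rightarrow> int ^ 'd \<Rightarrow> (int ^ 'd) set" where
  "dyadic_box n k = {x. \<forall>i. x $ i div 2 ^ n = k $ i}"

lemma dyadic_box_diff:
  assumes "x \<in> dyadic_box n k" "y \<in> dyadic_box n k"
  shows "x - y \<in> cubeV n"
  unfolding cubeV_def
proof (intro CollectI allI)
  fix i
  have "x $ i div 2 ^ n = y $ i div 2 ^ n"
    using assms by (simp add: dyadic_box_def)
  then have "x $ i - y $ i = x $ i mod 2 ^ n - y $ i mod 2 ^ n"
    by (simp flip: minus_mult_div_eq_mod)
  moreover have "0 \<le> x $ i mod 2 ^ n" "x $ i mod 2 ^ n < 2 ^ n"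
    "0 \<le> y $ i mod 2 ^ n" "y $ i mod 2 ^ n < 2 ^ n"
    by simp_all
  ultimately show "- (2 ^ n) \<le> (x - y) $ i \<and> (x - y) $ i < 2 ^ n"
    unfolding vector_minus_component by linarith
qed

lemma finite_dyadic_box: "finite (dyadic_box n k)"
proof (cases "dyadic_box n k = {}")
  case False
  then obtain y where "y \<in> dyadic_box n k" by blast
  then have "(\<lambda>x. x - y) ` dyadic_box n k \<subseteq> cubeV n"
    by (auto intro: dyadic_box_diff)
  then show ?thesis
    by (rule inj_on_finite[rotated]) (auto simp: inj_on_def)
qed simp

lemma cubeV_Suc_subset_dyadic_boxes: "cubeV (Suc n) \<subseteq> (\<Union>k\<in>cubeV 1. dyadic_box n k)"
proof
  fix x :: "int ^ 'd" assume x: "x \<in> cubeV (Suc n)"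
  define k :: "int ^ 'd" where "k = (\<chi> i. x $ i div 2 ^ n)"
  have "- 2 \<le> x $ i div 2 ^ n \<and> x $ i div 2 ^ n < 2" for i
  proof -
    have "- 2 * 2 ^ n \<le> x $ i" "x $ i < 2 * 2 ^ n" using x by (auto simp: cubeV_def)
    moreover have "x $ i div 2 ^ n * 2 ^ n = x $ i - x $ i mod 2 ^ n"
      "x $ i mod 2 ^ n < 2 ^ n" "0 \<le> x $ i mod 2 ^ n"
      by (simp_all add: minus_mod_eq_div_mult)
    ultimately have "- 3 * 2 ^ n < x $ i div 2 ^ n * 2 ^ n" "x $ i div 2 ^ n * 2 ^ n < 2 * 2 ^ n"
      by linarith+
    then show ?thesis
      unfolding mult_less_cancel_right by simp
  qed
  then have "k \<in> cubeV 1" by (simp add: k_def cubeV_def)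
  moreover have "x \<in> dyadic_box n k" by (simp add: k_def dyadic_box_def)
  ultimately show "x \<in> (\<Union>k\<in>cubeV 1. dyadic_box n k)" by blast
qed

lemma eucl_norm_eq_norm: "eucl_norm x = norm (\<chi> i. real_of_int (x $ i))"
  by (simp add: eucl_norm_def norm_vec_def L2_set_def)

lemma abs_le_eucl_norm: "\<bar>real_of_int (x $ i)\<bar> \<le> eucl_norm x"
  using component_le_norm_cart[of "\<chi> i. real_of_int (x $ i)" i] by (simp add: eucl_norm_eq_norm)

lemma eucl_norm_ge_of_notin_cubeV:
  assumes "x \<notin> cubeV n"
  shows "2 ^ n \<le> eucl_norm x"
proof -
  obtain i where "2 ^ n \<le> \<bar>x $ i\<bar>"
    using assms unfolding cubeV_def by simp (smt (verit))
  then have "2 ^ n \<le> \<bar>real_of_int (x $ i)\<bar>"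
    by (metis of_int_abs of_int_le_iff of_int_numeral of_int_power)
  then show ?thesis
    using abs_le_eucl_norm by (rule order_trans)
qed

lemma eucl_norm_ge_1:
  assumes "x \<noteq> 0"
  shows "1 \<le> eucl_norm x"
proof -
  obtain i where "x $ i \<noteq> 0" using assms by (auto simp: vec_eq_iff)
  then have "1 \<le> \<bar>real_of_int (x $ i)\<bar>"
    by linarith
  then show ?thesis
    using abs_le_eucl_norm by (rule order_trans)
qed

lemma eucl_norm_le_of_in_cubeV:
  fixes x :: "int ^ 'd"
  assumes "x \<in> cubeV n"
  shows "eucl_norm x \<le> sqrt (real CARD('d)) * 2 ^ n"
proof -
  have "(real_of_int (x $ i))\<^sup>2 \<le> (2 ^ n)\<^sup>2" for i
  proof -
    have "\<bar>x $ i\<bar> \<le> 2 ^ n" using assms by (simp add: cubeV_def abs_le_iff minus_le_iff less_imp_le)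
    then have "\<bar>real_of_int (x $ i)\<bar> \<le> 2 ^ n"
      by (metis of_int_abs of_int_le_iff of_int_numeral of_int_power)
    then show ?thesis by (simp add: abs_le_square_iff[symmetric])
  qed
  then have "(\<Sum>i\<in>(UNIV::'d set). (real_of_int (x $ i))\<^sup>2) \<le> real CARD('d) * (2 ^ n)\<^sup>2"
    by (intro sum_bounded_above) auto
  then have "eucl_norm x \<le> sqrt (real CARD('d) * (2 ^ n)\<^sup>2)"
    unfolding eucl_norm_def by (rule real_sqrt_le_mono)
  then show ?thesis by (simp add: real_sqrt_mult)
qed

lemma cubeV_comparable_normE:
  assumes "x \<noteq> 0"
  obtains n where "x \<in> cubeV n" "2 ^ n \<le> 2 * eucl_norm x"
proof -
  obtain n where n: "x \<in> cubeV n" "\<And>m. m < n \<Longrightarrow> x \<notin> cubeV m"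
    using eventually_happens'[OF _ eventually_in_cubeV] exists_least_iff[of "\<lambda>n. x \<in> cubeV n"]
    by (metis trivial_limit_sequentially)
  have "2 ^ n \<le> 2 * eucl_norm x"
  proof (cases n)
    case 0
    then show ?thesis using eucl_norm_ge_1[OF assms] by simp
  next
    case (Suc m)
    then show ?thesis using eucl_norm_ge_of_notin_cubeV[OF n(2), of m] by simp
  qed
  with n(1) show thesis by (rule that)
qed

subsection \<open>Exponential growth rates\<close>

definition growth_rate :: "(nat \<Rightarrow> real) \<Rightarrow> ereal" where
  "growth_rate f = limsup (\<lambda>n. ereal (log 2 (f n) / real n))"

text \<open>The hypothesis on \<open>\<gamma>\<close> is due to the junk value \<open>log 2 0 = 0\<close>.\<close>
lemma growth_rate_le_of_eventually_le:
  assumes gamma_nonneg: "0 \<le> \<gamma>" and nonneg: "\<And>n. 0 \<le> f n"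
    and eventually_le: "\<forall>\<^sub>F n in sequentially. f n \<le> K * 2 powr (\<gamma> * real n)"
  shows "growth_rate f \<le> ereal \<gamma>"
proof -
  define L where "L = max K 1"
  have "(\<lambda>n. \<gamma> + log 2 L / real n) \<longlonglongrightarrow> \<gamma> + 0"
    by (intro tendsto_add tendsto_const lim_const_over_n)
  then have limsup_eq: "limsup (\<lambda>n. ereal (\<gamma> + log 2 L / real n)) = ereal \<gamma>"
    by (intro lim_imp_Limsup) simp_all
  have "\<forall>\<^sub>F n in sequentially. ereal (log 2 (f n) / real n) \<le> ereal (\<gamma> + log 2 L / real n)"
    using eventually_le eventually_gt_at_top[of 0]
  proof eventually_elim
    case (elim n)
    have "log 2 (f n) \<le> log 2 L + \<gamma> * real n"
    proof (cases "f n = 0")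
      case False
      have "f n \<le> L * 2 powr (\<gamma> * real n)"
        using elim(1) by (rule order_trans) (simp add: L_def)
      then have "log 2 (f n) \<le> log 2 (L * 2 powr (\<gamma> * real n))"
        using nonneg[of n] False by (intro log_mono) simp_all
      then show ?thesis
        using log_mult_pos[of L "2 powr (\<gamma> * real n)" 2] by (simp add: L_def)
    next
      case True
      then have "log 2 (f n) = 0" by (simp add: log_def)
      moreover have "0 \<le> log 2 L" by (simp add: L_def)
      ultimately show ?thesis using gamma_nonneg by simp
    qed
    then show ?case using elim by (simp add: field_simps)
  qed
  then have "growth_rate f \<le> limsup (\<lambda>n. ereal (\<gamma> + log 2 L / real n))"
    unfolding growth_rate_def by (rule Limsup_mono)
  then show ?thesis using limsup_eq by simp
qed

lemma growth_rate_leI: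
  assumes "0 \<le> c" "\<And>n. 0 \<le> f n"
    and eventually_le: "\<And>\<gamma>. c < ereal \<gamma> \<Longrightarrow> \<exists>K. \<forall>\<^sub>F n in sequentially. f n \<le> K * 2 powr (\<gamma> * real n)"
  shows "growth_rate f \<le> c"
proof (rule dense_ge)
  fix y assume "c < y"
  then obtain \<gamma> where \<gamma>: "c < ereal \<gamma>" "ereal \<gamma> < y" using ereal_dense2 by blast
  then have "0 < ereal \<gamma>" using assms(1) by (blast intro: le_less_trans)
  then have "growth_rate f \<le> ereal \<gamma>"
    using eventually_le[OF \<gamma>(1)] assms(2) by (auto intro: growth_rate_le_of_eventually_le)
  then show "growth_rate f \<le> y" using \<gamma>(2) by simp
qed

lemma eventually_le_of_growth_rate_less:
  assumes "growth_rate f < ereal \<gamma>"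
  shows "\<forall>\<^sub>F n in sequentially. f n \<le> 2 powr (\<gamma> * real n)"
proof -
  have "\<forall>\<^sub>F n in sequentially. ereal (log 2 (f n) / real n) < ereal \<gamma>"
    using assms unfolding growth_rate_def by (rule Limsup_lessD)
  then show ?thesis
    using eventually_gt_at_top[of 0]
  proof eventually_elim
    case (elim n)
    then have "log 2 (f n) \<le> \<gamma> * real n" by (simp add: field_simps)
    then show ?case
      by (cases "0 < f n") (simp_all add: log_le_iff order_trans[OF _ powr_ge_zero])
  qed
qed

lemma le_growth_rate_of_frequently_ge:
  assumes frequently_ge: "\<exists>\<^sub>F n in sequentially. 2 powr (\<gamma> * real n) \<le> f n"
  shows "ereal \<gamma> \<le> growth_rate f"
proof (rule ccontr)
  assume "\<not> ?thesis"
  then obtain \<beta> where \<beta>: "growth_rate f < ereal \<beta>" "\<beta> < \<gamma>"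
    using ereal_dense2[of "growth_rate f" "ereal \<gamma>"] by (auto simp: not_le)
  have "\<forall>\<^sub>F n in sequentially. \<not> 2 powr (\<gamma> * real n) \<le> f n"
    using eventually_le_of_growth_rate_less[OF \<beta>(1)] eventually_gt_at_top[of 0]
  proof eventually_elim
    case (elim n)
    then have "2 powr (\<beta> * real n) < 2 powr (\<gamma> * real n)" using \<beta>(2) by simp
    then show ?case using elim(1) by linarith
  qed
  with frequently_ge show False by (simp add: frequently_def)
qed

lemma frequently_ge_of_less_growth_rate:
  assumes "0 \<le> \<gamma>" "\<And>n. 0 \<le> f n" and less: "ereal \<gamma> < growth_rate f"
  shows "\<exists>\<^sub>F n in sequentially. K * 2 powr (\<gamma> * real n) \<le> f n"
proof (rule ccontr)
  assume "\<not> ?thesis"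
  then have "\<forall>\<^sub>F n in sequentially. f n \<le> K * 2 powr (\<gamma> * real n)"
    by (auto simp: frequently_def elim: eventually_mono)
  with assms(1,2) have "growth_rate f \<le> ereal \<gamma>"
    by (rule growth_rate_le_of_eventually_le)
  with less show False by simp
qed

lemma growth_rate_nonneg:
  assumes "\<And>n. 0 \<le> log 2 (f n)"
  shows "0 \<le> growth_rate f"
proof -
  have "limsup (\<lambda>n::nat. 0::ereal) \<le> growth_rate f"
    unfolding growth_rate_def using assms by (intro Limsup_mono always_eventually) simp
  then show ?thesis by (simp add: Limsup_const)
qed

lemma summable_of_growth_rate_less:
  assumes nonneg: "\<And>n. 0 \<le> f n" and less: "growth_rate f < ereal \<gamma>"
  shows "summable (\<lambda>n. f n / 2 powr (\<gamma> * real n))"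
proof -
  obtain \<beta> where \<beta>: "growth_rate f < ereal \<beta>" "\<beta> < \<gamma>"
    using ereal_dense2[OF less] by auto
  show ?thesis
  proof (rule summable_comparison_test_ev)
    show "\<forall>\<^sub>F n in sequentially. norm (f n / 2 powr (\<gamma> * real n)) \<le> (2 powr (\<beta> - \<gamma>)) ^ n"
      using eventually_le_of_growth_rate_less[OF \<beta>(1)]
    proof eventually_elim
      case (elim n)
      have "norm (f n / 2 powr (\<gamma> * real n)) \<le> 2 powr (\<beta> * real n) / 2 powr (\<gamma> * real n)"
        using elim nonneg[of n] by (simp add: divide_right_mono)
      also have "\<dots> = 2 powr ((\<beta> - \<gamma>) * real n)"
        by (simp add: left_diff_distrib powr_diff)
      also have "\<dots> = (2 powr (\<beta> - \<gamma>)) ^ n"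
        by (simp add: powr_powr flip: powr_realpow)
      finally show ?case .
    qed
    show "summable (\<lambda>n. (2 powr (\<beta> - \<gamma>)) ^ n)"
      using \<beta>(2) by (intro summable_geometric) (simp add: powr_less_one)
  qed
qed

subsection \<open>Macroscopic Minkowski dimension\<close>

lemma upper_mink_dim_eq_growth_rate:
  "upper_mink_dim A = growth_rate (\<lambda>n. real (card (A \<inter> cubeV n)))"
  by (simp add: upper_mink_dim_def growth_rate_def)

lemma upper_mink_dim_nonneg: "0 \<le> upper_mink_dim A"
  unfolding upper_mink_dim_eq_growth_rate
proof (rule growth_rate_nonneg)
  show "0 \<le> log 2 (real (card (A \<inter> cubeV n)))" for n
  proof (cases "card (A \<inter> cubeV n) = 0")
    case False
    then have "1 \<le> real (card (A \<inter> cubeV n))" by linarith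
    then show ?thesis by simp
  qed (simp add: log_def)
qed

lemma eventually_card_le_of_upper_mink_dim_less:
  "upper_mink_dim A < ereal \<gamma> \<Longrightarrow>
    \<forall>\<^sub>F n in sequentially. real (card (A \<inter> cubeV n)) \<le> 2 powr (\<gamma> * real n)"
  unfolding upper_mink_dim_eq_growth_rate by (rule eventually_le_of_growth_rate_less)

lemma upper_mink_dim_mono:
  assumes "A \<subseteq> B"
  shows "upper_mink_dim A \<le> upper_mink_dim B"
  unfolding upper_mink_dim_eq_growth_rate[of A]
proof (rule growth_rate_leI[OF upper_mink_dim_nonneg])
  fix \<gamma> assume "upper_mink_dim B < ereal \<gamma>"
  then have "\<forall>\<^sub>F n in sequentially. real (card (B \<inter> cubeV n)) \<le> 2 powr (\<gamma> * real n)"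
    by (rule eventually_card_le_of_upper_mink_dim_less)
  moreover have "card (A \<inter> cubeV n) \<le> card (B \<inter> cubeV n)" for n
    using assms by (intro card_mono) auto
  ultimately have "\<forall>\<^sub>F n in sequentially. real (card (A \<inter> cubeV n)) \<le> 1 * 2 powr (\<gamma> * real n)"
    by (auto elim!: eventually_mono intro: order_trans[OF of_nat_mono])
  then show "\<exists>K. \<forall>\<^sub>F n in sequentially. real (card (A \<inter> cubeV n)) \<le> K * 2 powr (\<gamma> * real n)" ..
qed simp

lemma upper_mink_dim_Un_finite:
  assumes "finite F"
  shows "upper_mink_dim (F \<union> A) = upper_mink_dim A"
proof (rule antisym)
  show "upper_mink_dim (F \<union> A) \<le> upper_mink_dim A"
    unfolding upper_mink_dim_eq_growth_rate[of "F \<union> A"]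
  proof (rule growth_rate_leI[OF upper_mink_dim_nonneg])
    fix \<gamma> assume less: "upper_mink_dim A < ereal \<gamma>"
    then have "0 \<le> \<gamma>" using le_less_trans[OF upper_mink_dim_nonneg less] by simp
    from eventually_card_le_of_upper_mink_dim_less[OF less]
    have "\<forall>\<^sub>F n in sequentially.
        real (card ((F \<union> A) \<inter> cubeV n)) \<le> (real (card F) + 1) * 2 powr (\<gamma> * real n)"
    proof eventually_elim
      case (elim n)
      have "card ((F \<union> A) \<inter> cubeV n) \<le> card (F \<union> (A \<inter> cubeV n))"
        using assms by (intro card_mono) auto
      also have "\<dots> \<le> card F + card (A \<inter> cubeV n)" by (rule card_Un_le)
      finally have "real (card ((F \<union> A) \<inter> cubeV n)) \<le> real (card F) * 1 + 2 powr (\<gamma> * real n)"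
        using elim by linarith
      also have "\<dots> \<le> real (card F) * 2 powr (\<gamma> * real n) + 2 powr (\<gamma> * real n)"
        using \<open>0 \<le> \<gamma>\<close> by (intro add_right_mono mult_left_mono ge_one_powr_ge_zero) auto
      finally show ?case by (simp add: algebra_simps)
    qed
    then show "\<exists>K. \<forall>\<^sub>F n in sequentially.
        real (card ((F \<union> A) \<inter> cubeV n)) \<le> K * 2 powr (\<gamma> * real n)" ..
  qed simp
qed (rule upper_mink_dim_mono, simp)

lemma upper_mink_dim_translation_le: "upper_mink_dim ((+) a ` A) \<le> upper_mink_dim A"
  unfolding upper_mink_dim_eq_growth_rate[of "(+) a ` A"]
proof (rule growth_rate_leI[OF upper_mink_dim_nonneg])
  fix \<gamma> assume "upper_mink_dim A < ereal \<gamma>"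
  then have "\<forall>\<^sub>F n in sequentially. real (card (A \<inter> cubeV (Suc n))) \<le> 2 powr (\<gamma> * real (Suc n))"
    by (intro eventually_sequentially_Suc[THEN iffD2] eventually_card_le_of_upper_mink_dim_less)
  then have "\<forall>\<^sub>F n in sequentially.
      real (card ((+) a ` A \<inter> cubeV n)) \<le> 2 powr \<gamma> * 2 powr (\<gamma> * real n)"
    using eventually_in_cubeV[of a]
  proof eventually_elim
    case (elim n)
    have "(\<lambda>y. y - a) ` ((+) a ` A \<inter> cubeV n) \<subseteq> A \<inter> cubeV (Suc n)"
      using cubeV_diff[OF _ elim(2)] by auto
    then have "card ((\<lambda>y. y - a) ` ((+) a ` A \<inter> cubeV n)) \<le> card (A \<inter> cubeV (Suc n))"
      by (intro card_mono) auto
    then have "real (card ((+) a ` A \<inter> cubeV n)) \<le> 2 powr (\<gamma> * real (Suc n))"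
      using elim(1) by (simp add: card_image inj_on_def)
    then show ?case by (simp add: algebra_simps flip: powr_add)
  qed
  then show "\<exists>K. \<forall>\<^sub>F n in sequentially.
      real (card ((+) a ` A \<inter> cubeV n)) \<le> K * 2 powr (\<gamma> * real n)" ..
qed simp

lemma upper_mink_dim_translation: "upper_mink_dim ((+) a ` A) = upper_mink_dim A"
proof (rule antisym)
  have "upper_mink_dim ((+) (- a) ` ((+) a ` A)) \<le> upper_mink_dim ((+) a ` A)"
    by (rule upper_mink_dim_translation_le)
  then show "upper_mink_dim A \<le> upper_mink_dim ((+) a ` A)" by (simp add: image_image)
qed (rule upper_mink_dim_translation_le)

subsection \<open>The critical exponent\<close>

definition cube_sum :: "(int ^ 'd \<Rightarrow> real) \<Rightarrow> nat \<Rightarrow> real" where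
  "cube_sum f n = (\<Sum>x\<in>cubeV n. f x)"

definition riesz_sum :: "(int ^ 'd \<Rightarrow> real) \<Rightarrow> real \<Rightarrow> ennreal" where
  "riesz_sum f \<gamma> = (\<integral>\<^sup>+ x. ennreal (f x / eucl_norm x powr \<gamma>) \<partial>count_space (UNIV - {0}))"

lemma sum_le_riesz_sum:
  assumes nonneg: "\<And>x. 0 \<le> f x" and finite: "riesz_sum f \<gamma> < \<top>" and A: "finite A" "0 \<notin> A"
  shows "(\<Sum>x\<in>A. f x / eucl_norm x powr \<gamma>) \<le> enn2real (riesz_sum f \<gamma>)"
proof -
  have "ennreal (\<Sum>x\<in>A. f x / eucl_norm x powr \<gamma>) = (\<Sum>x\<in>A. ennreal (f x / eucl_norm x powr \<gamma>))"
    using nonneg by (intro sum_ennreal[symmetric]) simp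
  also have "\<dots> = (\<integral>\<^sup>+ x. ennreal (f x / eucl_norm x powr \<gamma>) * indicator A x
      \<partial>count_space (UNIV - {0}))"
    using A by (subst nn_integral_count_space'[of A]) auto
  also have "\<dots> \<le> riesz_sum f \<gamma>"
    unfolding riesz_sum_def by (intro nn_integral_mono) (simp add: indicator_def)
  also have "\<dots> = ennreal (enn2real (riesz_sum f \<gamma>))"
    using finite by simp
  finally show ?thesis by (simp add: ennreal_le_iff)
qed

lemma growth_rate_cube_sum_le_of_riesz_sum_finite:
  fixes f :: "int ^ 'd \<Rightarrow> real"
  assumes nonneg: "\<And>x. 0 \<le> f x" and gamma_nonneg: "0 \<le> \<gamma>" and finite: "riesz_sum f \<gamma> < \<top>"
  shows "growth_rate (cube_sum f) \<le> ereal \<gamma>"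
proof (rule growth_rate_le_of_eventually_le[OF gamma_nonneg _ always_eventually[OF allI]])
  fix n
  show "0 \<le> cube_sum f n" using nonneg by (simp add: cube_sum_def sum_nonneg)
  define R where "R = enn2real (riesz_sum f \<gamma>)"
  define s where "s = sqrt (real CARD('d)) powr \<gamma>"
  define D where "D = (sqrt (real CARD('d)) * 2 ^ n) powr \<gamma>"
  have D_eq: "D = s * 2 powr (\<gamma> * real n)"
    by (simp add: D_def s_def powr_mult powr_powr mult.commute flip: powr_realpow)
  have "f x \<le> D * (f x / eucl_norm x powr \<gamma>)" if "x \<in> cubeV n - {0}" for x
  proof -
    have pos: "0 < eucl_norm x" using eucl_norm_ge_1[of x] that by auto
    then have "eucl_norm x powr \<gamma> \<le> D"
      unfolding D_def using that gamma_nonneg by (intro powr_mono2 eucl_norm_le_of_in_cubeV) auto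
    then have "eucl_norm x powr \<gamma> * f x \<le> D * f x" using nonneg by (rule mult_right_mono)
    then show ?thesis using pos by (simp add: field_simps)
  qed
  then have "(\<Sum>x\<in>cubeV n - {0}. f x) \<le> (\<Sum>x\<in>cubeV n - {0}. D * (f x / eucl_norm x powr \<gamma>))"
    by (rule sum_mono)
  also have "\<dots> \<le> D * R"
    unfolding sum_distrib_left[symmetric] R_def
    by (intro mult_left_mono sum_le_riesz_sum nonneg finite) (auto simp: D_def)
  finally have "cube_sum f n \<le> f 0 * 1 + D * R"
    by (simp add: cube_sum_def sum.remove[of "cubeV n" 0])
  also have "\<dots> \<le> f 0 * 2 powr (\<gamma> * real n) + D * R"
    using nonneg gamma_nonneg by (intro add_right_mono mult_left_mono ge_one_powr_ge_zero) auto
  finally show "cube_sum f n \<le> (f 0 + s * R) * 2 powr (\<gamma> * real n)"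
    by (simp add: D_eq algebra_simps)
qed

lemma riesz_summand_le_dyadic_sum:
  assumes nonneg: "0 \<le> f x" and "0 < \<gamma>" "x \<noteq> 0"
  shows "ennreal (f x / eucl_norm x powr \<gamma>)
    \<le> ennreal (2 powr \<gamma>) * (\<Sum>n. ennreal (f x / 2 powr (\<gamma> * real n)) * indicator (cubeV n) x)"
proof -
  let ?h = "\<lambda>n. ennreal (f x / 2 powr (\<gamma> * real n)) * indicator (cubeV n) x"
  obtain n where n: "x \<in> cubeV n" "2 ^ n \<le> 2 * eucl_norm x"
    using cubeV_comparable_normE[OF \<open>x \<noteq> 0\<close>] .
  have pos: "0 < eucl_norm x" using eucl_norm_ge_1[OF \<open>x \<noteq> 0\<close>] by simp
  have "2 powr (\<gamma> * real n) = (2 ^ n) powr \<gamma>"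
    by (simp add: powr_powr mult.commute flip: powr_realpow)
  also have "\<dots> \<le> (2 * eucl_norm x) powr \<gamma>"
    using n(2) \<open>0 < \<gamma>\<close> by (intro powr_mono2) auto
  also have "\<dots> = 2 powr \<gamma> * eucl_norm x powr \<gamma>"
    using pos by (simp add: powr_mult)
  finally have "f x * 2 powr (\<gamma> * real n) \<le> f x * (2 powr \<gamma> * eucl_norm x powr \<gamma>)"
    using nonneg by (rule mult_left_mono)
  then have "f x / eucl_norm x powr \<gamma> \<le> 2 powr \<gamma> * (f x / 2 powr (\<gamma> * real n))"
    using pos by (simp add: field_simps)
  then have "ennreal (f x / eucl_norm x powr \<gamma>) \<le> ennreal (2 powr \<gamma>) * ?h n"
    using nonneg n(1) by (simp add: ennreal_leI flip: ennreal_mult)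
  also have "\<dots> \<le> ennreal (2 powr \<gamma>) * (\<Sum>n. ?h n)"
    using sum_le_suminf[OF summableI, of "{n}" ?h]
    by (intro mult_left_mono) (simp_all del: sum_mult_indicator)
  finally show ?thesis .
qed

lemma riesz_sum_finite_of_growth_rate_less:
  fixes f :: "int ^ 'd \<Rightarrow> real"
  assumes nonneg: "\<And>x. 0 \<le> f x" and gamma_pos: "0 < \<gamma>"
    and less: "growth_rate (cube_sum f) < ereal \<gamma>"
  shows "riesz_sum f \<gamma> < \<top>"
proof -
  let ?N = "count_space (UNIV - {0 :: int ^ 'd})"
  let ?h = "\<lambda>n x. ennreal (f x / 2 powr (\<gamma> * real n)) * indicator (cubeV n) x"
  have cube_sum_nonneg: "0 \<le> cube_sum f n" for n
    using nonneg by (simp add: cube_sum_def sum_nonneg)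
  have integral_cube_le: "(\<integral>\<^sup>+ x. ?h n x \<partial>?N) \<le> ennreal (cube_sum f n / 2 powr (\<gamma> * real n))" for n
  proof -
    have "(\<integral>\<^sup>+ x. ?h n x \<partial>?N) = (\<Sum>x\<in>cubeV n - {0}. ?h n x)"
      by (rule nn_integral_count_space') (auto split: split_indicator)
    also have "\<dots> \<le> (\<Sum>x\<in>cubeV n. ?h n x)"
      by (intro sum_mono2) auto
    also have "\<dots> = ennreal (cube_sum f n / 2 powr (\<gamma> * real n))"
      using nonneg by (simp add: cube_sum_def sum_divide_distrib indicator_def)
    finally show ?thesis .
  qed
  have "riesz_sum f \<gamma> \<le> (\<integral>\<^sup>+ x. ennreal (2 powr \<gamma>) * (\<Sum>n. ?h n x) \<partial>?N)"
    unfolding riesz_sum_def using nonneg gamma_pos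
    by (intro nn_integral_mono riesz_summand_le_dyadic_sum) auto
  also have "\<dots> = ennreal (2 powr \<gamma>) * (\<Sum>n. \<integral>\<^sup>+ x. ?h n x \<partial>?N)"
    by (simp add: nn_integral_cmult nn_integral_suminf)
  also have "\<dots> \<le> ennreal (2 powr \<gamma>) * (\<Sum>n. ennreal (cube_sum f n / 2 powr (\<gamma> * real n)))"
    by (intro mult_left_mono suminf_le summableI integral_cube_le) simp
  also have "\<dots> < \<top>"
  proof -
    have "(\<Sum>n. ennreal (cube_sum f n / 2 powr (\<gamma> * real n))) \<noteq> \<top>"
      using cube_sum_nonneg
      by (intro ennreal_suminf_neq_top summable_of_growth_rate_less less) auto
    then show ?thesis by (simp add: ennreal_mult_less_top less_top)
  qed
  finally show ?thesis .
qed

lemma Inf_eq_of_threshold: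
  fixes r b :: real
  assumes "r \<le> b" and bounds: "S \<subseteq> {r..<b}" "{r<..<b} \<subseteq> S"
  shows "(if S = {} then b else Inf S) = r"
proof (cases "S = {}")
  case True
  then have "\<not> r < b" using bounds(2) by auto
  then show ?thesis using True \<open>r \<le> b\<close> by simp
next
  case False
  have "Inf S = r"
  proof (rule cInf_eq_non_empty[OF False])
    fix y assume lower_bound: "\<And>x. x \<in> S \<Longrightarrow> y \<le> x"
    obtain s where "s \<in> S" using False by blast
    then have "y \<le> s" "s < b" "r < b" using lower_bound bounds(1) by force+
    show "y \<le> r"
    proof (rule dense_ge_bounded[OF \<open>r < b\<close>])
      show "y \<le> w" if "r < w" "w < b" for w using that bounds(2) lower_bound by auto
    qed
  qed (use bounds(1) in auto)
  then show ?thesis using False by simp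
qed

lemma critical_exponent_eq_growth_rate:
  fixes f :: "int ^ 'd \<Rightarrow> real"
  assumes nonneg: "\<And>x. 0 \<le> f x"
    and rate: "0 \<le> growth_rate (cube_sum f)" "growth_rate (cube_sum f) \<le> ereal (real CARD('d))"
  defines "S \<equiv> {\<gamma>. 0 < \<gamma> \<and> \<gamma> < real CARD('d) \<and> riesz_sum f \<gamma> < \<top>}"
  shows "ereal (if S = {} then real CARD('d) else Inf S) = growth_rate (cube_sum f)"
proof -
  obtain r where rate_eq: "growth_rate (cube_sum f) = ereal r"
    using rate by (cases "growth_rate (cube_sum f)") auto
  have "(if S = {} then real CARD('d) else Inf S) = r"
  proof (rule Inf_eq_of_threshold)
    show "S \<subseteq> {r..<real CARD('d)}"
      using growth_rate_cube_sum_le_of_riesz_sum_finite[of f] nonneg rate_eq by (auto simp: S_def)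
    show "{r<..<real CARD('d)} \<subseteq> S"
      using riesz_sum_finite_of_growth_rate_less[of f] nonneg rate_eq rate(1) by (auto simp: S_def)
  qed (use rate rate_eq in simp)
  then show ?thesis by (simp only: rate_eq)
qed

subsection \<open>Probabilistic tools\<close>

lemma (in prob_space) Paley_Zygmund:
  fixes f :: "'a \<Rightarrow> real"
  assumes borel_f [measurable]: "f \<in> borel_measurable M" and nonneg: "\<And>x. 0 \<le> f x"
    and square_integrable: "integrable M (\<lambda>x. (f x)\<^sup>2)" and a: "0 \<le> a" "a \<le> expectation f"
  shows "(expectation f - a)\<^sup>2 \<le> expectation (\<lambda>x. (f x)\<^sup>2) * prob {x \<in> space M. a \<le> f x}"
proof -
  define A where "A = {x \<in> space M. a \<le> f x}"
  have A_sets [measurable]: "A \<in> sets M" unfolding A_def by measurable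
  have integrable_f: "integrable M f"
    using borel_f square_integrable by (rule square_integrable_imp_integrable)
  then have integrable_fA: "integrable M (\<lambda>x. f x * indicator A x)"
    by (rule integrable_real_mult_indicator[OF A_sets])
  have "expectation f \<le> expectation (\<lambda>x. a + f x * indicator A x)"
    using integrable_f integrable_fA a(1) by (intro integral_mono) (auto simp: A_def indicator_def)
  then have "expectation f - a \<le> expectation (\<lambda>x. f x * indicator A x)"
    using integrable_fA by (simp add: prob_space)
  then have "(expectation f - a)\<^sup>2 \<le> (expectation (\<lambda>x. f x * indicator A x))\<^sup>2"
    using a(2) by (intro power_mono) auto
  also have "\<dots> \<le> expectation (\<lambda>x. (f x)\<^sup>2) * prob A"
  proof -
    have "(\<integral>\<^sup>+ x. ennreal (f x) * indicator A x \<partial>M)\<^sup>2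
        \<le> (\<integral>\<^sup>+ x. (ennreal (f x))\<^sup>2 \<partial>M) * (\<integral>\<^sup>+ x. (indicator A x)\<^sup>2 \<partial>M)"
      by (rule Cauchy_Schwarz_nn_integral) auto
    also have "(\<integral>\<^sup>+ x. (indicator A x)\<^sup>2 \<partial>M) = ennreal (prob A)"
      by (simp add: power2_eq_square emeasure_eq_measure flip: indicator_inter_arith)
    also have "(\<integral>\<^sup>+ x. (ennreal (f x))\<^sup>2 \<partial>M) = ennreal (expectation (\<lambda>x. (f x)\<^sup>2))"
      using square_integrable nonneg
      by (subst nn_integral_eq_integral[symmetric]) (auto simp: ennreal_power)
    also have "(\<integral>\<^sup>+ x. ennreal (f x) * indicator A x \<partial>M)
        = ennreal (expectation (\<lambda>x. f x * indicator A x))"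
      using integrable_fA nonneg
      by (subst nn_integral_eq_integral[symmetric]) (auto simp: ennreal_mult ennreal_indicator)
    finally show ?thesis
      using nonneg by (simp add: ennreal_power flip: ennreal_mult)
  qed
  finally show ?thesis by (simp add: A_def)
qed

lemma (in finite_measure) measure_limsup_ge:
  assumes [measurable]: "\<And>n. A n \<in> sets M"
    and frequently_ge: "\<exists>\<^sub>F n in sequentially. c \<le> measure M (A n)"
  shows "c \<le> measure M (limsup A)"
proof -
  have "(\<lambda>n. measure M (\<Union>k\<in>{n..}. A k)) \<longlonglongrightarrow> measure M (\<Inter>n. \<Union>k\<in>{n..}. A k)"
  proof (rule finite_Lim_measure_decseq)
    show "decseq (\<lambda>n. \<Union>k\<in>{n..}. A k)"
      unfolding decseq_def by (intro allI impI UN_mono) auto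
  qed auto
  moreover have "c \<le> measure M (\<Union>k\<in>{n..}. A k)" for n
  proof -
    obtain k where k: "n \<le> k" "c \<le> measure M (A k)"
      using frequently_ge by (auto simp: frequently_sequentially)
    moreover have "measure M (A k) \<le> measure M (\<Union>k\<in>{n..}. A k)"
      using k(1) by (intro finite_measure_mono) auto
    ultimately show ?thesis by linarith
  qed
  ultimately have "c \<le> measure M (\<Inter>n. \<Union>k\<in>{n..}. A k)"
    by (intro LIMSEQ_le_const) auto
  then show ?thesis by (simp add: limsup_INF_SUP)
qed

lemma AE_ge_of_AE_ge_reals:
  fixes f :: "'a \<Rightarrow> ereal"
  assumes "\<And>\<gamma>. ereal \<gamma> < c \<Longrightarrow> AE x in M. ereal \<gamma> \<le> f x"
  shows "AE x in M. c \<le> f x"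
proof -
  have "AE x in M. \<forall>r::rat. ereal (real_of_rat r) < c \<longrightarrow> ereal (real_of_rat r) \<le> f x"
    using assms by (simp add: AE_all_countable)
  then show ?thesis
  proof eventually_elim
    case (elim x)
    show ?case
    proof (rule ccontr)
      assume "\<not> ?thesis"
      then obtain r where "f x < ereal (real_of_rat r)" "ereal (real_of_rat r) < c"
        using ereal_dense3[of "f x" c] by (auto simp: not_le)
      then show False using elim by (auto simp: not_le[symmetric])
    qed
  qed
qed

lemma AE_le_of_AE_le_reals:
  fixes f :: "'a \<Rightarrow> ereal"
  assumes "\<And>\<gamma>. c < ereal \<gamma> \<Longrightarrow> AE x in M. f x \<le> ereal \<gamma>"
  shows "AE x in M. f x \<le> c"
proof -
  have le_uminus: "ereal \<gamma> \<le> - y \<longleftrightarrow> y \<le> ereal (- \<gamma>)" for \<gamma> y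
    by (cases y) auto
  have "AE x in M. - c \<le> - f x"
  proof (rule AE_ge_of_AE_ge_reals)
    fix \<gamma> assume "ereal \<gamma> < - c"
    then have "c < ereal (- \<gamma>)" by (cases c) auto
    then show "AE x in M. ereal \<gamma> \<le> - f x"
      unfolding le_uminus by (rule assms)
  qed
  then show ?thesis by simp
qed

lemma (in prob_space) distr_shift_iid:
  fixes X :: "nat \<Rightarrow> 'a \<Rightarrow> 'b"
  assumes indep: "indep_vars (\<lambda>_. N) X UNIV" and ident: "\<And>i. distr M N (X i) = distr M N (X 0)"
  shows "distr M (PiM UNIV (\<lambda>_. N)) (\<lambda>\<omega> i. X (k + i) \<omega>) = distr M (PiM UNIV (\<lambda>_. N)) (\<lambda>\<omega> i. X i \<omega>)"
proof -
  let ?P = "PiM UNIV (\<lambda>_. N)"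
  have random_variable_X [measurable]: "X i \<in> measurable M N" for i
    using indep by (auto simp: indep_vars_def)
  have prob_law: "prob_space (distr M N (X i))" for i
    by (rule prob_space_distr) measurable
  have joint_law: "distr M ?P (\<lambda>\<omega> i. X i \<omega>) = PiM UNIV (\<lambda>i. distr M N (X i))"
    using indep_vars_iff_distr_eq_PiM[of UNIV X "\<lambda>_. N"] indep by (simp add: restrict_def)
  have "distr M ?P (\<lambda>\<omega> i. X (k + i) \<omega>) = distr (distr M ?P (\<lambda>\<omega> i. X i \<omega>)) ?P (\<lambda>f i. f (k + i))"
  proof (subst distr_distr)
    show "(\<lambda>f i. f (k + i)) \<in> measurable ?P ?P"
      by (rule measurable_PiM_single') (auto simp: space_PiM PiE_iff)
    show "(\<lambda>\<omega> i. X i \<omega>) \<in> measurable M ?P"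
      using measurable_space[OF random_variable_X]
      by (intro measurable_PiM_single') (auto simp: PiE_iff)
  qed (simp add: comp_def)
  also have "\<dots> = distr (PiM UNIV (\<lambda>i. distr M N (X i))) (PiM UNIV (\<lambda>i. distr M N (X (k + i))))
      (\<lambda>f. \<lambda>i\<in>UNIV. f (k + i))"
    unfolding joint_law by (intro distr_cong sets_PiM_cong) auto
  also have "\<dots> = PiM UNIV (\<lambda>i. distr M N (X (k + i)))"
    using prob_law by (intro distr_PiM_reindex) auto
  also have "\<dots> = PiM UNIV (\<lambda>i. distr M N (X i))"
    by (intro PiM_cong refl) (metis ident)
  finally show ?thesis by (simp only: joint_law)
qed

lemma measurable_shift_tail_sigma:
  fixes X :: "nat \<Rightarrow> 'a \<Rightarrow> 'b"
  assumes measurable_X: "\<And>i. X i \<in> measurable M N"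
  shows "(\<lambda>\<omega> i. X (k + i) \<omega>) \<in> measurable
    (sigma (space M) (\<Union>i\<in>{k..}. {X i -` C \<inter> space M |C. C \<in> sets N})) (PiM UNIV (\<lambda>_. N))"
proof -
  let ?S = "\<Union>i\<in>{k..}. {X i -` C \<inter> space M |C. C \<in> sets N}"
  let ?T = "sigma (space M) ?S"
  have S_subset_Pow: "?S \<subseteq> Pow (space M)" by auto
  have "X (k + i) \<in> measurable ?T N" for i
  proof (rule measurableI)
    fix C assume "C \<in> sets N"
    then have "X (k + i) -` C \<inter> space M \<in> ?S" by (intro UN_I[of "k + i"]) auto
    then show "X (k + i) -` C \<inter> space ?T \<in> sets ?T"
      using S_subset_Pow by (simp add: sets_measure_of space_measure_of sigma_sets.Basic)
  qed (use S_subset_Pow measurable_space[OF measurable_X] in \<open>simp add: space_measure_of\<close>)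
  then show ?thesis
    by (intro measurable_PiM_single') (auto simp: PiE_UNIV_domain dest: measurable_space)
qed

lemma (in prob_space) zero_one_of_shift_invariant:
  fixes X :: "nat \<Rightarrow> 'a \<Rightarrow> 'b"
  assumes indep: "indep_vars (\<lambda>_. N) X UNIV"
    and [measurable]: "B \<in> sets (PiM UNIV (\<lambda>_. N))"
    and invariant: "\<And>k \<omega>. (\<lambda>i. X (k + i) \<omega>) \<in> B \<longleftrightarrow> (\<lambda>i. X i \<omega>) \<in> B"
  shows "prob {\<omega> \<in> space M. (\<lambda>i. X i \<omega>) \<in> B} = 0 \<or> prob {\<omega> \<in> space M. (\<lambda>i. X i \<omega>) \<in> B} = 1"
proof -
  let ?E = "{\<omega> \<in> space M. (\<lambda>i. X i \<omega>) \<in> B}"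
  let ?A = "\<lambda>i. {X i -` C \<inter> space M |C. C \<in> sets N}"
  have measurable_X: "X i \<in> measurable M N" for i
    using indep by (auto simp: indep_vars_def)
  have "?E \<in> sigma_sets (space M) (\<Union> (?A ` {k..}))" for k
  proof -
    let ?T = "sigma (space M) (\<Union> (?A ` {k..}))"
    have subset_Pow: "\<Union> (?A ` {k..}) \<subseteq> Pow (space M)" by auto
    note [measurable] = measurable_shift_tail_sigma[OF measurable_X]
    have "{\<omega> \<in> space ?T. (\<lambda>i. X (k + i) \<omega>) \<in> B} \<in> sets ?T" by measurable
    then show ?thesis
      using subset_Pow by (simp add: invariant sets_measure_of space_measure_of)
  qed
  then have "?E \<in> tail_events ?A" by (simp add: tail_events_def)
  moreover have "sigma_algebra (space M) (?A i)" for i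
  proof -
    have "?A i = sets (vimage_algebra (space M) (X i) N)"
      using measurable_space[OF measurable_X] by (intro sets_vimage_algebra2[symmetric]) auto
    then show ?thesis
      using sets.sigma_algebra_axioms[of "vimage_algebra (space M) (X i) N"]
      by (simp only: space_vimage_algebra)
  qed
  moreover have "indep_sets ?A UNIV"
    using indep by (auto simp: indep_vars_def2)
  ultimately show ?thesis by (intro kolmogorov_0_1_law)
qed

lemma suminf_convolution_le:
  fixes Q :: "nat \<Rightarrow> nat \<Rightarrow> ennreal"
  shows "(\<Sum>n. \<Sum>k\<le>n. Q k (n - k)) \<le> (\<Sum>k. \<Sum>m. Q k m)"
proof (rule suminf_le_const[OF summableI])
  fix N
  have "(\<Sum>n<N. \<Sum>k\<le>n. Q k (n - k)) = (\<Sum>(k, m)\<in>{(k, m). k + m < N}. Q k m)"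
    by (rule sum.triangle_reindex[symmetric])
  also have "\<dots> \<le> (\<Sum>(k, m)\<in>{..<N} \<times> {..<N}. Q k m)"
    by (intro sum_mono2) auto
  also have "\<dots> = (\<Sum>k<N. \<Sum>m<N. Q k m)"
    by (simp add: sum.cartesian_product)
  also have "\<dots> \<le> (\<Sum>k<N. \<Sum>m. Q k m)"
    by (intro sum_mono sum_le_suminf) auto
  also have "\<dots> \<le> (\<Sum>k. \<Sum>m. Q k m)"
    by (intro sum_le_suminf) auto
  finally show "(\<Sum>n<N. \<Sum>k\<le>n. Q k (n - k)) \<le> (\<Sum>k. \<Sum>m. Q k m)" .
qed

subsection \<open>Paths\<close>

lemma walk_add: "walk \<xi> (k + m) \<omega> = walk \<xi> k \<omega> + walk (\<lambda>i. \<xi> (k + i)) m \<omega>"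
  by (induction m) (simp_all add: walk_def add.assoc)

lemma range_walk_shift:
  "range_walk \<xi> \<omega> = (\<lambda>j. walk \<xi> j \<omega>) ` {..<k} \<union> (+) (walk \<xi> k \<omega>) ` range_walk (\<lambda>i. \<xi> (k + i)) \<omega>"
proof -
  have "range_walk \<xi> \<omega> = (\<lambda>j. walk \<xi> j \<omega>) ` ({..<k} \<union> (+) k ` UNIV)"
  proof -
    have "j \<in> (+) k ` UNIV" if "\<not> j < k" for j
      using that by (intro image_eqI[of _ _ "j - k"]) auto
    then have "{..<k} \<union> (+) k ` UNIV = UNIV" by auto
    then show ?thesis by (auto simp: range_walk_def)
  qed
  also have "\<dots> = (\<lambda>j. walk \<xi> j \<omega>) ` {..<k} \<union> (\<lambda>m. walk \<xi> (k + m) \<omega>) ` UNIV"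
    by (simp add: image_Un image_image)
  also have "(\<lambda>m. walk \<xi> (k + m) \<omega>) ` UNIV = (+) (walk \<xi> k \<omega>) ` range_walk (\<lambda>i. \<xi> (k + i)) \<omega>"
    by (auto simp: walk_add range_walk_def)
  finally show ?thesis .
qed

lemma upper_mink_dim_range_walk_shift:
  "upper_mink_dim (range_walk (\<lambda>i. \<xi> (k + i)) \<omega>) = upper_mink_dim (range_walk \<xi> \<omega>)"
  unfolding range_walk_shift[of \<xi> \<omega> k]
  by (simp add: upper_mink_dim_Un_finite upper_mink_dim_translation)

lemma measurable_walk:
  fixes \<xi> :: "nat \<Rightarrow> 'w \<Rightarrow> int ^ 'd"
  assumes [measurable]: "\<And>i. \<xi> i \<in> measurable M (count_space UNIV)"
  shows "walk \<xi> n \<in> measurable M (count_space UNIV)"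
proof (induction n)
  case 0
  show ?case unfolding walk_def by simp
next
  case (Suc n)
  note [measurable] = Suc
  have "(\<lambda>\<omega>. walk \<xi> n \<omega> + \<xi> n \<omega>) \<in> measurable M (count_space UNIV)"
    by measurable
  then show ?case unfolding walk_def by simp
qed

lemma measurable_upper_mink_dim_range_walk:
  fixes \<xi> :: "nat \<Rightarrow> 'w \<Rightarrow> int ^ 'd"
  assumes "\<And>i. \<xi> i \<in> measurable M (count_space UNIV)"
  shows "(\<lambda>\<omega>. upper_mink_dim (range_walk \<xi> \<omega>)) \<in> borel_measurable M"
proof -
  note [measurable] = measurable_walk[OF assms]
  have "real (card (range_walk \<xi> \<omega> \<inter> cubeV n))
      = (\<Sum>x\<in>cubeV n. if \<exists>k. walk \<xi> k \<omega> = x then 1 else 0)" for n \<omega>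
  proof -
    have range_Int_cubeV: "range_walk \<xi> \<omega> \<inter> cubeV n = {x\<in>cubeV n. \<exists>k. walk \<xi> k \<omega> = x}"
      by (auto simp: range_walk_def)
    show ?thesis unfolding range_Int_cubeV by (simp flip: sum.inter_filter)
  qed
  then show ?thesis
    unfolding upper_mink_dim_def by simp
qed

subsection \<open>Random walks and their Green measure\<close>

locale random_walk = prob_space M for M :: "'w measure" +
  fixes \<xi> :: "nat \<Rightarrow> 'w \<Rightarrow> int ^ 'd"
  assumes measurable_step [measurable]: "\<And>i. \<xi> i \<in> measurable M (count_space UNIV)"
    and indep_steps: "indep_vars (\<lambda>_. count_space UNIV) \<xi> UNIV"
    and ident_steps: "\<And>i. distr M (count_space UNIV) (\<xi> i) = distr M (count_space UNIV) (\<xi> 0)"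
begin

lemma measurable_position [measurable]: "walk \<xi> n \<in> measurable M (count_space UNIV)"
  by (rule measurable_walk) measurable

lemma measurable_dim_range [measurable]:
  "(\<lambda>\<omega>. upper_mink_dim (range_walk \<xi> \<omega>)) \<in> borel_measurable M"
  by (rule measurable_upper_mink_dim_range_walk) measurable

lemma dim_range_zero_one:
  "prob {\<omega> \<in> space M. \<gamma> \<le> upper_mink_dim (range_walk \<xi> \<omega>)} = 0 \<or>
   prob {\<omega> \<in> space M. \<gamma> \<le> upper_mink_dim (range_walk \<xi> \<omega>)} = 1"
proof -
  let ?P = "PiM UNIV (\<lambda>_::nat. count_space (UNIV :: (int ^ 'd) set))"
  let ?B = "{f \<in> space ?P. \<gamma> \<le> upper_mink_dim (range_walk (\<lambda>i f. f i) f)}"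
  have [measurable]: "(\<lambda>f. upper_mink_dim (range_walk (\<lambda>i f. f i) f)) \<in> borel_measurable ?P"
    by (rule measurable_upper_mink_dim_range_walk) measurable
  have B_sets: "?B \<in> sets ?P" by measurable
  have shifted: "(\<lambda>i. \<xi> (k + i) \<omega>) \<in> ?B \<longleftrightarrow> \<gamma> \<le> upper_mink_dim (range_walk \<xi> \<omega>)" for k \<omega>
    unfolding upper_mink_dim_range_walk_shift[of \<xi> k \<omega>, symmetric]
    by (simp add: space_PiM range_walk_def walk_def)
  note path = shifted[of 0, unfolded add_0]
  show ?thesis
    using zero_one_of_shift_invariant[OF indep_steps B_sets, unfolded shifted path] by simp
qed

lemma emeasure_walk_shift:
  "emeasure M {\<omega> \<in> space M. walk (\<lambda>i. \<xi> (k + i)) m \<omega> \<in> C}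
    = emeasure M {\<omega> \<in> space M. walk \<xi> m \<omega> \<in> C}"
proof -
  let ?P = "PiM UNIV (\<lambda>_::nat. count_space (UNIV :: (int ^ 'd) set))"
  let ?F = "{f \<in> space ?P. walk (\<lambda>i f. f i) m f \<in> C}"
  have [measurable]: "walk (\<lambda>i f. f i) m \<in> measurable ?P (count_space UNIV)"
    by (rule measurable_walk) measurable
  have F_sets: "?F \<in> sets ?P" by measurable
  have "emeasure M {\<omega> \<in> space M. walk (\<lambda>i. \<xi> (k + i)) m \<omega> \<in> C}
      = emeasure (distr M ?P (\<lambda>\<omega> i. \<xi> (k + i) \<omega>)) ?F" for k
    by (subst emeasure_distr[OF measurable_PiM_single' F_sets])
       (auto intro!: arg_cong2[where f=emeasure] simp: walk_def space_PiM)
  from this[of k] this[of 0] show ?thesis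
    unfolding distr_shift_iid[OF indep_steps ident_steps, of k] by simp
qed

lemma emeasure_past_Int_future:
  "emeasure M {\<omega> \<in> space M. Q (\<lambda>i\<in>{..<k}. \<xi> i \<omega>) \<and> walk (\<lambda>i. \<xi> (k + i)) m \<omega> \<in> C}
    = emeasure M {\<omega> \<in> space M. Q (\<lambda>i\<in>{..<k}. \<xi> i \<omega>)} * emeasure M {\<omega> \<in> space M. walk \<xi> m \<omega> \<in> C}"
proof -
  let ?c = "\<lambda>_::nat. count_space (UNIV :: (int ^ 'd) set)"
  let ?J = "{k..<k + m}"
  have PiM_eq_count_space: "PiM J ?c = count_space (PiE J (\<lambda>_. UNIV))" if "finite J" for J
    using that by (rule count_space_PiM_finite) simp
  let ?A = "{f \<in> PiE {..<k} (\<lambda>_. UNIV). Q f}"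
  let ?B = "{f \<in> PiE ?J (\<lambda>_. UNIV). walk (\<lambda>i f. f (k + i)) m f \<in> C}"
  have "indep_var (PiM {..<k} ?c) (\<lambda>\<omega>. \<lambda>i\<in>{..<k}. \<xi> i \<omega>) (PiM ?J ?c) (\<lambda>\<omega>. \<lambda>i\<in>?J. \<xi> i \<omega>)"
    by (rule indep_var_restrict[OF indep_steps]) auto
  from indep_varD[OF this, of ?A ?B]
  have "prob ((\<lambda>\<omega>. (\<lambda>i\<in>{..<k}. \<xi> i \<omega>, \<lambda>i\<in>?J. \<xi> i \<omega>)) -` (?A \<times> ?B) \<inter> space M)
    = prob ((\<lambda>\<omega>. \<lambda>i\<in>{..<k}. \<xi> i \<omega>) -` ?A \<inter> space M) * prob ((\<lambda>\<omega>. \<lambda>i\<in>?J. \<xi> i \<omega>) -` ?B \<inter> space M)"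
    by (auto simp: PiM_eq_count_space)
  also have "(\<lambda>\<omega>. \<lambda>i\<in>{..<k}. \<xi> i \<omega>) -` ?A \<inter> space M = {\<omega> \<in> space M. Q (\<lambda>i\<in>{..<k}. \<xi> i \<omega>)}"
    by auto
  also have future_eq: "(\<lambda>\<omega>. \<lambda>i\<in>?J. \<xi> i \<omega>) -` ?B \<inter> space M
    = {\<omega> \<in> space M. walk (\<lambda>i. \<xi> (k + i)) m \<omega> \<in> C}"
    by (auto simp: walk_def)
  also have "(\<lambda>\<omega>. (\<lambda>i\<in>{..<k}. \<xi> i \<omega>, \<lambda>i\<in>?J. \<xi> i \<omega>)) -` (?A \<times> ?B) \<inter> space M
    = {\<omega> \<in> space M. Q (\<lambda>i\<in>{..<k}. \<xi> i \<omega>) \<and> walk (\<lambda>i. \<xi> (k + i)) m \<omega> \<in> C}"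
    using future_eq by auto
  finally show ?thesis
    unfolding emeasure_walk_shift[of k, symmetric]
    by (simp only: emeasure_eq_measure ennreal_mult measure_nonneg)
qed

definition visits_at :: "nat \<Rightarrow> (int ^ 'd) set \<Rightarrow> 'w set" where
  "visits_at n A = {\<omega> \<in> space M. walk \<xi> n \<omega> \<in> A}"

definition enters_at :: "(int ^ 'd) set \<Rightarrow> nat \<Rightarrow> int ^ 'd \<Rightarrow> 'w set" where
  "enters_at A k b = {\<omega> \<in> space M. walk \<xi> k \<omega> = b \<and> (\<forall>j<k. walk \<xi> j \<omega> \<notin> A)}"

definition hit :: "(int ^ 'd) set \<Rightarrow> 'w set" where
  "hit A = (\<Union>n. visits_at n A)"

definition green_measure :: "(int ^ 'd) set \<Rightarrow> ennreal" where
  "green_measure A = (\<Sum>n. emeasure M (visits_at n A))"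

lemma visits_at_sets [measurable]: "visits_at n A \<in> sets M"
  unfolding visits_at_def by measurable

lemma enters_at_sets [measurable]: "enters_at A k b \<in> sets M"
  unfolding enters_at_def by measurable

lemma hit_sets [measurable]: "hit A \<in> sets M"
  unfolding hit_def by measurable

lemma enters_at_empty: "enters_at {} k b = visits_at k {b}"
  by (simp add: enters_at_def visits_at_def)

lemma Markov_property:
  "emeasure M (enters_at A k b \<inter> visits_at (k + m) C)
    = emeasure M (enters_at A k b) * emeasure M (visits_at m {x. x + b \<in> C})"
proof -
  define Q where "Q f \<longleftrightarrow> (\<Sum>i<k. f i) = b \<and> (\<forall>j<k. (\<Sum>i<j. f i) \<notin> A)" for f
  have walk_restrict: "(\<Sum>i<j. restrict (\<lambda>i. \<xi> i \<omega>) {..<k} i) = walk \<xi> j \<omega>" if "j \<le> k" for j \<omega>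
    unfolding walk_def using that by (intro sum.cong) auto
  have Q_iff: "Q (\<lambda>i\<in>{..<k}. \<xi> i \<omega>) \<longleftrightarrow> walk \<xi> k \<omega> = b \<and> (\<forall>j<k. walk \<xi> j \<omega> \<notin> A)" for \<omega>
    unfolding Q_def by (simp only: walk_restrict less_imp_le order_refl cong: conj_cong imp_cong)
  have "enters_at A k b \<inter> visits_at (k + m) C
    = {\<omega> \<in> space M. Q (\<lambda>i\<in>{..<k}. \<xi> i \<omega>) \<and> walk (\<lambda>i. \<xi> (k + i)) m \<omega> \<in> {x. x + b \<in> C}}"
    unfolding Q_iff by (auto simp: enters_at_def visits_at_def walk_add add.commute)
  then show ?thesis
    using emeasure_past_Int_future[of Q k m "{x. x + b \<in> C}"]
    unfolding Q_iff by (simp add: enters_at_def visits_at_def)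
qed

lemma visits_at_subset_enters_at:
  "visits_at n A \<subseteq> (\<Union>k\<le>n. \<Union>b\<in>A. enters_at A k b)"
proof
  fix \<omega> assume \<omega>: "\<omega> \<in> visits_at n A"
  define k where "k = (LEAST k. walk \<xi> k \<omega> \<in> A)"
  have "walk \<xi> k \<omega> \<in> A" "k \<le> n" "\<forall>j<k. walk \<xi> j \<omega> \<notin> A"
    using \<omega> by (auto simp: visits_at_def k_def intro: LeastI Least_le dest: not_less_Least)
  with \<omega> show "\<omega> \<in> (\<Union>k\<le>n. \<Union>b\<in>A. enters_at A k b)"
    by (auto simp: visits_at_def enters_at_def)
qed

lemma hit_eq_UN_enters_at: "hit A = (\<Union>k. \<Union>b\<in>A. enters_at A k b)"
proof
  show "hit A \<subseteq> (\<Union>k. \<Union>b\<in>A. enters_at A k b)"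
    using visits_at_subset_enters_at by (fastforce simp: hit_def)
qed (auto simp: hit_def visits_at_def enters_at_def)

lemma emeasure_hit:
  assumes "finite A"
  shows "emeasure M (hit A) = (\<Sum>k. \<Sum>b\<in>A. emeasure M (enters_at A k b))"
proof -
  have "(\<Sum>b\<in>A. emeasure M (enters_at A k b)) = emeasure M (\<Union>b\<in>A. enters_at A k b)" for k
    using assms by (intro sum_emeasure) (auto simp: disjoint_family_on_def enters_at_def)
  moreover have "(\<Sum>k. emeasure M (\<Union>b\<in>A. enters_at A k b)) = emeasure M (\<Union>k. \<Union>b\<in>A. enters_at A k b)"
  proof (rule suminf_emeasure)
    show "disjoint_family (\<lambda>k. \<Union>b\<in>A. enters_at A k b)"
      unfolding disjoint_family_on_def enters_at_def using nat_neq_iff by auto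
  qed (use assms in \<open>auto intro!: sets.finite_UN\<close>)
  ultimately show ?thesis by (simp add: hit_eq_UN_enters_at)
qed

lemma emeasure_visits_at_le_first_entrance:
  assumes "finite A"
  shows "emeasure M (visits_at n A)
    \<le> (\<Sum>k\<le>n. \<Sum>b\<in>A. emeasure M (enters_at A k b) * emeasure M (visits_at (n - k) {x. x + b \<in> A}))"
proof -
  have "visits_at n A \<subseteq> (\<Union>k\<le>n. \<Union>b\<in>A. enters_at A k b \<inter> visits_at (k + (n - k)) A)"
    using visits_at_subset_enters_at by fastforce
  then have "emeasure M (visits_at n A)
      \<le> emeasure M (\<Union>k\<le>n. \<Union>b\<in>A. enters_at A k b \<inter> visits_at (k + (n - k)) A)"
    using assms by (intro emeasure_mono sets.finite_UN) auto
  also have "\<dots> \<le> (\<Sum>k\<le>n. emeasure M (\<Union>b\<in>A. enters_at A k b \<inter> visits_at (k + (n - k)) A))"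
    using assms by (intro emeasure_subadditive_finite image_subsetI sets.finite_UN) auto
  also have "\<dots> \<le> (\<Sum>k\<le>n. \<Sum>b\<in>A. emeasure M (enters_at A k b \<inter> visits_at (k + (n - k)) A))"
    using assms by (intro sum_mono emeasure_subadditive_finite image_subsetI) auto
  finally show ?thesis by (simp only: Markov_property)
qed

lemma emeasure_hit_le_green_measure: "emeasure M (hit A) \<le> green_measure A"
  unfolding hit_def green_measure_def by (rule emeasure_subadditive_countably) auto

lemma green_measure_singleton: "green_measure {x} = green0 M \<xi> x"
  by (simp add: green_measure_def visits_at_def green0_def)

lemma green_measure_mono: "A \<subseteq> B \<Longrightarrow> green_measure A \<le> green_measure B"
  unfolding green_measure_def
  by (intro suminf_le emeasure_mono summableI) (auto simp: visits_at_def)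

lemma green_measure_UN_le:
  assumes "finite I"
  shows "green_measure (\<Union>i\<in>I. A i) \<le> (\<Sum>i\<in>I. green_measure (A i))"
proof -
  have "emeasure M (visits_at n (\<Union>i\<in>I. A i)) \<le> (\<Sum>i\<in>I. emeasure M (visits_at n (A i)))" for n
  proof -
    have "visits_at n (\<Union>i\<in>I. A i) = (\<Union>i\<in>I. visits_at n (A i))"
      by (auto simp: visits_at_def)
    then show ?thesis
      using assms by (simp only:) (rule emeasure_subadditive_finite, auto)
  qed
  then have "green_measure (\<Union>i\<in>I. A i) \<le> (\<Sum>n. \<Sum>i\<in>I. emeasure M (visits_at n (A i)))"
    unfolding green_measure_def by (intro suminf_le summableI)
  then show ?thesis
    by (simp add: green_measure_def suminf_sum summableI)
qed

lemma green_measure_eq_sum: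
  assumes "finite A"
  shows "green_measure A = (\<Sum>x\<in>A. green0 M \<xi> x)"
proof -
  have "emeasure M (visits_at n A) = (\<Sum>x\<in>A. emeasure M (visits_at n {x}))" for n
  proof -
    have "(\<Sum>x\<in>A. emeasure M (visits_at n {x})) = emeasure M (\<Union>x\<in>A. visits_at n {x})"
      using assms by (intro sum_emeasure) (auto simp: disjoint_family_on_def visits_at_def)
    also have "(\<Union>x\<in>A. visits_at n {x}) = visits_at n A"
      by (auto simp: visits_at_def)
    finally show ?thesis by simp
  qed
  then have "green_measure A = (\<Sum>x\<in>A. green_measure {x})"
    unfolding green_measure_def by (simp add: suminf_sum summableI)
  then show ?thesis by (simp add: green_measure_singleton)
qed

text \<open>From its first point in \<open>A\<close> on, the walk is a fresh walk, and it visits \<open>A\<close> only when its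
  displacement from that point lies in \<open>B\<close>.\<close>
lemma green_measure_le_hit_mult:
  assumes finite_A: "finite A" and diff: "\<And>x y. x \<in> A \<Longrightarrow> y \<in> A \<Longrightarrow> x - y \<in> B"
  shows "green_measure A \<le> emeasure M (hit A) * green_measure B"
proof -
  have shifted: "green_measure {x. x + b \<in> A} \<le> green_measure B" if "b \<in> A" for b
    using diff[OF _ that] by (intro green_measure_mono) force
  have "green_measure A
    \<le> (\<Sum>n. \<Sum>k\<le>n. \<Sum>b\<in>A. emeasure M (enters_at A k b)
        * emeasure M (visits_at (n - k) {x. x + b \<in> A}))"
    unfolding green_measure_def
    by (intro suminf_le summableI emeasure_visits_at_le_first_entrance finite_A)
  also have "\<dots>
    \<le> (\<Sum>k. \<Sum>m. \<Sum>b\<in>A. emeasure M (enters_at A k b) * emeasure M (visits_at m {x. x + b \<in> A}))"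
    by (rule suminf_convolution_le)
  also have "\<dots> = (\<Sum>k. \<Sum>b\<in>A. emeasure M (enters_at A k b) * green_measure {x. x + b \<in> A})"
    by (simp add: suminf_sum summableI green_measure_def)
  also have "\<dots> \<le> (\<Sum>k. \<Sum>b\<in>A. emeasure M (enters_at A k b) * green_measure B)"
    by (intro suminf_le summableI sum_mono mult_left_mono shifted) auto
  also have "\<dots> = emeasure M (hit A) * green_measure B"
    by (simp add: emeasure_hit[OF finite_A] flip: sum_distrib_right)
  finally show ?thesis .
qed

lemma green_measure_cubeV_Suc_le:
  "green_measure (cubeV (Suc n))
    \<le> of_nat (card (cubeV 1 :: (int ^ 'd) set)) * green_measure (cubeV n)"
proof -
  have box_le: "green_measure (dyadic_box n k) \<le> green_measure (cubeV n)" for k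
  proof -
    have "green_measure (dyadic_box n k)
        \<le> emeasure M (hit (dyadic_box n k)) * green_measure (cubeV n)"
      by (intro green_measure_le_hit_mult finite_dyadic_box dyadic_box_diff)
    also have "\<dots> \<le> 1 * green_measure (cubeV n)"
      by (intro mult_right_mono measure_le_1) simp
    finally show ?thesis by simp
  qed
  have "green_measure (cubeV (Suc n)) \<le> green_measure (\<Union>k\<in>cubeV 1. dyadic_box n k)"
    by (intro green_measure_mono cubeV_Suc_subset_dyadic_boxes)
  also have "\<dots> \<le> (\<Sum>k\<in>(cubeV 1 :: (int ^ 'd) set). green_measure (dyadic_box n k))"
    by (rule green_measure_UN_le) simp
  also have "\<dots> \<le> (\<Sum>k\<in>(cubeV 1 :: (int ^ 'd) set). green_measure (cubeV n))"
    by (intro sum_mono box_le)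
  finally show ?thesis by simp
qed

lemma green0_le_hit: "green0 M \<xi> x \<le> emeasure M (hit {x}) * green0 M \<xi> 0"
  using green_measure_le_hit_mult[of "{x}" "{0}"] by (simp add: green_measure_singleton)

lemma emeasure_visit_then_visit_le:
  "emeasure M (\<Union>j. \<Union>m. visits_at j {x} \<inter> visits_at (j + m) {y}) \<le> green0 M \<xi> x * green0 M \<xi> (y - x)"
proof -
  have "{z. z + x = y} = {y - x}" by (auto simp: eq_diff_eq)
  then have Markov: "emeasure M (visits_at j {x} \<inter> visits_at (j + m) {y})
      = emeasure M (visits_at j {x}) * emeasure M (visits_at m {y - x})" for j m
    using Markov_property[of "{}" j x m "{y}"] by (simp add: enters_at_empty)
  have "emeasure M (\<Union>j. \<Union>m. visits_at j {x} \<inter> visits_at (j + m) {y})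
    \<le> (\<Sum>j. emeasure M (\<Union>m. visits_at j {x} \<inter> visits_at (j + m) {y}))"
    by (intro emeasure_subadditive_countably) auto
  also have "\<dots> \<le> (\<Sum>j. \<Sum>m. emeasure M (visits_at j {x} \<inter> visits_at (j + m) {y}))"
    by (intro suminf_le summableI emeasure_subadditive_countably) auto
  also have "\<dots> = green_measure {x} * green_measure {y - x}"
    by (simp add: green_measure_def Markov)
  finally show ?thesis by (simp only: green_measure_singleton)
qed

lemma emeasure_hit_two_le:
  "emeasure M (hit {x} \<inter> hit {y})
    \<le> green0 M \<xi> x * green0 M \<xi> (y - x) + green0 M \<xi> y * green0 M \<xi> (x - y)"
proof -
  let ?E = "\<lambda>x y. \<Union>j. \<Union>m. visits_at j {x} \<inter> visits_at (j + m) {y}"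
  have "hit {x} \<inter> hit {y} \<subseteq> ?E x y \<union> ?E y x"
  proof
    fix \<omega> assume "\<omega> \<in> hit {x} \<inter> hit {y}"
    then obtain j k where visits: "\<omega> \<in> visits_at j {x}" "\<omega> \<in> visits_at k {y}"
      by (auto simp: hit_def)
    show "\<omega> \<in> ?E x y \<union> ?E y x"
    proof (cases "j \<le> k")
      case True
      then have "\<omega> \<in> visits_at j {x} \<inter> visits_at (j + (k - j)) {y}" using visits by simp
      then show ?thesis by blast
    next
      case False
      then have "\<omega> \<in> visits_at k {y} \<inter> visits_at (k + (j - k)) {x}" using visits by simp
      then show ?thesis by blast
    qed
  qed
  then have "emeasure M (hit {x} \<inter> hit {y}) \<le> emeasure M (?E x y \<union> ?E y x)"
    by (intro emeasure_mono) auto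
  also have "\<dots> \<le> emeasure M (?E x y) + emeasure M (?E y x)"
    by (intro emeasure_subadditive) auto
  also have "\<dots> \<le> green0 M \<xi> x * green0 M \<xi> (y - x) + green0 M \<xi> y * green0 M \<xi> (x - y)"
    by (intro add_mono emeasure_visit_then_visit_le)
  finally show ?thesis .
qed

end

subsection \<open>Moments of the number of visited points\<close>

locale transient_random_walk = random_walk M \<xi>
  for M :: "'w measure" and \<xi> :: "nat \<Rightarrow> 'w \<Rightarrow> int ^ 'd" +
  assumes transient: "\<And>x. green0 M \<xi> x < \<top>"
begin

definition green :: "int ^ 'd \<Rightarrow> real" where
  "green x = enn2real (green0 M \<xi> x)"

definition range_count :: "nat \<Rightarrow> 'w \<Rightarrow> real" where
  "range_count n \<omega> = real (card (range_walk \<xi> \<omega> \<inter> cubeV n))"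

lemma green_nonneg [simp]: "0 \<le> green x"
  by (simp add: green_def)

lemma green0_eq: "green0 M \<xi> x = ennreal (green x)"
  using transient[of x] by (simp add: green_def)

lemma green_measure_cubeV: "green_measure (cubeV n) = ennreal (cube_sum green n)"
  by (simp add: green_measure_eq_sum cube_sum_def green0_eq)

lemma green_0_ge_1: "1 \<le> green 0"
proof -
  have "1 = emeasure M (visits_at 0 {0})"
    by (simp add: visits_at_def walk_def emeasure_space_1)
  also have "\<dots> \<le> emeasure M (hit {0})"
    by (intro emeasure_mono) (auto simp: hit_def)
  also have "\<dots> \<le> green0 M \<xi> 0"
    unfolding green_measure_singleton[symmetric] by (rule emeasure_hit_le_green_measure)
  finally show ?thesis by (simp add: green0_eq)
qed

lemma cube_sum_green_ge_1: "1 \<le> cube_sum green n"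
proof -
  have "green 0 \<le> cube_sum green n"
    unfolding cube_sum_def by (rule member_le_sum) auto
  with green_0_ge_1 show ?thesis by linarith
qed

lemma cube_sum_green_doubling: "cube_sum green (Suc n) \<le> 4 ^ CARD('d) * cube_sum green n"
proof -
  have "ennreal (cube_sum green (Suc n)) \<le> ennreal (4 ^ CARD('d)) * ennreal (cube_sum green n)"
    using green_measure_cubeV_Suc_le[of n]
    by (simp add: green_measure_cubeV card_cubeV ennreal_power flip: ennreal_numeral)
  then show ?thesis
    using cube_sum_green_ge_1[of n] by (simp add: ennreal_le_iff flip: ennreal_mult)
qed

lemma prob_hit_le: "prob (hit {x}) \<le> green x"
  using emeasure_hit_le_green_measure[of "{x}"]
  by (simp add: green_measure_singleton green0_eq emeasure_eq_measure)

lemma green_le_prob_hit: "green x \<le> green 0 * prob (hit {x})"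
  using green0_le_hit[of x]
  by (simp add: green0_eq emeasure_eq_measure mult.commute flip: ennreal_mult)

lemma prob_hit_two_le:
  "prob (hit {x} \<inter> hit {y}) \<le> green x * green (y - x) + green y * green (x - y)"
  using emeasure_hit_two_le[of x y]
  by (simp add: green0_eq emeasure_eq_measure flip: ennreal_mult ennreal_plus)

lemma upper_mink_dim_range_walk:
  "upper_mink_dim (range_walk \<xi> \<omega>) = growth_rate (\<lambda>n. range_count n \<omega>)"
  by (simp add: upper_mink_dim_eq_growth_rate range_count_def)

lemma range_count_eq_sum:
  assumes "\<omega> \<in> space M"
  shows "range_count n \<omega> = (\<Sum>x\<in>cubeV n. indicator (hit {x}) \<omega>)"
proof -
  have range_Int_cubeV: "range_walk \<xi> \<omega> \<inter> cubeV n = {x\<in>cubeV n. \<omega> \<in> hit {x}}"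
    using assms by (auto simp: hit_def visits_at_def range_walk_def)
  show ?thesis unfolding range_count_def range_Int_cubeV by (simp add: indicator_def Int_def)
qed

lemma measurable_range_count [measurable]: "range_count n \<in> borel_measurable M"
  by (subst measurable_cong[OF range_count_eq_sum]) auto

lemma integrable_range_count_power: "integrable M (\<lambda>\<omega>. range_count n \<omega> ^ p)"
proof (rule integrable_const_bound)
  have "range_count n \<omega> \<le> real (card (cubeV n :: (int ^ 'd) set))" for \<omega>
    unfolding range_count_def by (intro of_nat_mono card_mono) auto
  then show "AE \<omega> in M. norm (range_count n \<omega> ^ p) \<le> real (card (cubeV n :: (int ^ 'd) set)) ^ p"
    by (auto simp: range_count_def intro!: power_mono)
qed measurable

lemma expectation_range_count: "expectation (range_count n) = (\<Sum>x\<in>cubeV n. prob (hit {x}))"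
proof -
  have "expectation (range_count n) = expectation (\<lambda>\<omega>. \<Sum>x\<in>cubeV n. indicator (hit {x}) \<omega>)"
    by (intro Bochner_Integration.integral_cong) (auto simp: range_count_eq_sum)
  also have "\<dots> = (\<Sum>x\<in>cubeV n. prob (hit {x}))"
    by (subst Bochner_Integration.integral_sum) (auto simp: emeasure_eq_measure)
  finally show ?thesis .
qed

lemma expectation_range_count_le: "expectation (range_count n) \<le> cube_sum green n"
  unfolding expectation_range_count cube_sum_def by (intro sum_mono prob_hit_le)

lemma cube_sum_green_le: "cube_sum green n \<le> green 0 * expectation (range_count n)"
  unfolding expectation_range_count cube_sum_def sum_distrib_left
  by (intro sum_mono green_le_prob_hit)

lemma expectation_range_count_square:
  "expectation (\<lambda>\<omega>. (range_count n \<omega>)\<^sup>2) = (\<Sum>x\<in>cubeV n. \<Sum>y\<in>cubeV n. prob (hit {x} \<inter> hit {y}))"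
proof -
  have "(range_count n \<omega>)\<^sup>2 = (\<Sum>x\<in>cubeV n. \<Sum>y\<in>cubeV n. indicator (hit {x} \<inter> hit {y}) \<omega>)"
    if "\<omega> \<in> space M" for \<omega>
    unfolding range_count_eq_sum[OF that] power2_eq_square sum_product
    by (simp add: indicator_inter_arith)
  then have "expectation (\<lambda>\<omega>. (range_count n \<omega>)\<^sup>2)
    = expectation (\<lambda>\<omega>. \<Sum>x\<in>cubeV n. \<Sum>y\<in>cubeV n. indicator (hit {x} \<inter> hit {y}) \<omega>)"
    by (intro Bochner_Integration.integral_cong) auto
  also have "\<dots> = (\<Sum>x\<in>cubeV n. \<Sum>y\<in>cubeV n. prob (hit {x} \<inter> hit {y}))"
    by (subst Bochner_Integration.integral_sum)
       (auto simp: emeasure_eq_measure intro!: Bochner_Integration.integrable_sum)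
  finally show ?thesis .
qed

lemma expectation_range_count_square_le:
  "expectation (\<lambda>\<omega>. (range_count n \<omega>)\<^sup>2) \<le> 2 * cube_sum green n * cube_sum green (Suc n)"
proof -
  have translate_le: "(\<Sum>y\<in>cubeV n. green (y - x)) \<le> cube_sum green (Suc n)" if "x \<in> cubeV n" for x
  proof -
    have "(\<Sum>y\<in>cubeV n. green (y - x)) = (\<Sum>z\<in>(\<lambda>y. y - x) ` cubeV n. green z)"
      by (subst sum.reindex) (auto simp: inj_on_def)
    also have "\<dots> \<le> cube_sum green (Suc n)"
      unfolding cube_sum_def using that by (intro sum_mono2) (auto intro: cubeV_diff)
    finally show ?thesis .
  qed
  let ?S = "\<Sum>x\<in>cubeV n. \<Sum>y\<in>cubeV n. green x * green (y - x)"
  have "expectation (\<lambda>\<omega>. (range_count n \<omega>)\<^sup>2)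
      \<le> (\<Sum>x\<in>cubeV n. \<Sum>y\<in>cubeV n. green x * green (y - x) + green y * green (x - y))"
    unfolding expectation_range_count_square by (intro sum_mono prob_hit_two_le)
  also have "\<dots> = ?S + (\<Sum>x\<in>cubeV n. \<Sum>y\<in>cubeV n. green y * green (x - y))"
    by (simp add: sum.distrib)
  also have "(\<Sum>x\<in>cubeV n. \<Sum>y\<in>cubeV n. green y * green (x - y)) = ?S"
    by (rule sum.swap)
  also have "?S + ?S = 2 * (\<Sum>x\<in>cubeV n. green x * (\<Sum>y\<in>cubeV n. green (y - x)))"
    by (simp add: sum_distrib_left)
  also have "\<dots> \<le> 2 * (\<Sum>x\<in>cubeV n. green x * cube_sum green (Suc n))"
    by (intro mult_left_mono sum_mono translate_le) auto
  also have "\<dots> = 2 * cube_sum green n * cube_sum green (Suc n)"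
    by (simp add: cube_sum_def sum_distrib_right)
  finally show ?thesis .
qed

lemma prob_range_count_ge:
  "1 / (8 * 4 ^ CARD('d) * (green 0)\<^sup>2)
    \<le> prob {\<omega> \<in> space M. cube_sum green n / (2 * green 0) \<le> range_count n \<omega>}"
proof -
  define G where "G = cube_sum green n"
  define a where "a = G / (2 * green 0)"
  define m where "m = expectation (range_count n)"
  define q where "q = prob {\<omega> \<in> space M. a \<le> range_count n \<omega>}"
  have pos: "0 < G" "0 < green 0"
    using cube_sum_green_ge_1[of n] green_0_ge_1 by (simp_all add: G_def)
  have "2 * a \<le> m"
    using cube_sum_green_le[of n] pos by (simp add: a_def G_def m_def field_simps)
  moreover have "0 < a" using pos by (simp add: a_def)
  ultimately have "a\<^sup>2 \<le> (m - a)\<^sup>2"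
    by (intro power_mono) auto
  also have "\<dots> \<le> expectation (\<lambda>\<omega>. (range_count n \<omega>)\<^sup>2) * q"
    unfolding m_def q_def using \<open>2 * a \<le> m\<close> \<open>0 < a\<close>
    by (intro Paley_Zygmund integrable_range_count_power) (auto simp: m_def range_count_def)
  also have "\<dots> \<le> (2 * G * (4 ^ CARD('d) * G)) * q"
  proof (rule mult_right_mono)
    have "2 * G * cube_sum green (Suc n) \<le> 2 * G * (4 ^ CARD('d) * G)"
      unfolding G_def using pos by (intro mult_left_mono cube_sum_green_doubling) (simp add: G_def)
    then show "expectation (\<lambda>\<omega>. (range_count n \<omega>)\<^sup>2) \<le> 2 * G * (4 ^ CARD('d) * G)"
      using expectation_range_count_square_le[of n] by (simp add: G_def)
  qed (simp add: q_def)
  finally have "1 / (8 * 4 ^ CARD('d) * (green 0)\<^sup>2) \<le> q"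
    using pos by (simp add: a_def field_simps power2_eq_square)
  then show ?thesis by (simp add: q_def a_def G_def)
qed

subsection \<open>The dimension of the range\<close>

lemma riesz_sum_green:
  "riesz_sum green \<gamma>
    = (\<integral>\<^sup>+ x. green0 M \<xi> x / ennreal (eucl_norm x powr \<gamma>) \<partial>count_space (UNIV - {0}))"
  unfolding riesz_sum_def
proof (rule nn_integral_cong)
  fix x :: "int ^ 'd" assume "x \<in> space (count_space (UNIV - {0}))"
  then have "0 < eucl_norm x powr \<gamma>" using eucl_norm_ge_1[of x] by auto
  then show "ennreal (green x / eucl_norm x powr \<gamma>) = green0 M \<xi> x / ennreal (eucl_norm x powr \<gamma>)"
    by (simp add: green0_eq divide_ennreal)
qed

lemma growth_rate_green_nonneg: "0 \<le> growth_rate (cube_sum green)"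
proof (rule growth_rate_nonneg)
  show "0 \<le> log 2 (cube_sum green n)" for n
    using cube_sum_green_ge_1[of n] by simp
qed

lemma growth_rate_green_le_CARD: "growth_rate (cube_sum green) \<le> ereal (real CARD('d))"
proof (rule growth_rate_le_of_eventually_le[OF _ _ always_eventually[OF allI]])
  fix n
  show "0 \<le> cube_sum green n" using cube_sum_green_ge_1[of n] by simp
  have "cube_sum green n \<le> green 0 * expectation (range_count n)"
    by (rule cube_sum_green_le)
  also have "expectation (range_count n) \<le> (\<Sum>x\<in>(cubeV n :: (int ^ 'd) set). 1)"
    unfolding expectation_range_count by (intro sum_mono prob_le_1)
  also have "\<dots> = (2 * 2 ^ n) ^ CARD('d)"
    by (simp add: card_cubeV)
  also have "green 0 * (2 * 2 ^ n) ^ CARD('d)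
      = green 0 * 2 ^ CARD('d) * 2 powr (real CARD('d) * real n)"
    using powr_realpow[of 2 "CARD('d) * n"]
    by (simp add: power_mult_distrib mult.commute flip: power_mult)
  finally show "cube_sum green n \<le> green 0 * 2 ^ CARD('d) * 2 powr (real CARD('d) * real n)"
    by (simp add: mult_left_mono)
qed simp

lemma gamma_c_eq_growth_rate: "ereal (gamma_c M \<xi>) = growth_rate (cube_sum green)"
  unfolding gamma_c_def Let_def riesz_sum_green[symmetric]
  by (intro critical_exponent_eq_growth_rate green_nonneg growth_rate_green_nonneg
      growth_rate_green_le_CARD)

lemma AE_dim_range_le: "AE \<omega> in M. upper_mink_dim (range_walk \<xi> \<omega>) \<le> growth_rate (cube_sum green)"
proof (rule AE_le_of_AE_le_reals)
  fix \<gamma> assume less: "growth_rate (cube_sum green) < ereal \<gamma>"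
  have "0 \<le> \<gamma>" using le_less_trans[OF growth_rate_green_nonneg less] by simp
  define E where "E n = {\<omega> \<in> space M. 2 powr (\<gamma> * real n) \<le> range_count n \<omega>}" for n
  have [measurable]: "E n \<in> sets M" for n unfolding E_def by measurable
  have prob_E: "prob (E n) \<le> cube_sum green n / 2 powr (\<gamma> * real n)" for n
  proof -
    have "prob (E n) \<le> expectation (range_count n) / 2 powr (\<gamma> * real n)"
      unfolding E_def using integrable_range_count_power[of n 1]
      by (intro integral_Markov_inequality_measure[where A = "{}"]) (auto simp: range_count_def)
    also have "\<dots> \<le> cube_sum green n / 2 powr (\<gamma> * real n)"
      by (intro divide_right_mono expectation_range_count_le) simp
    finally show ?thesis .
  qed
  have "summable (\<lambda>n. cube_sum green n / 2 powr (\<gamma> * real n))"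
    using less order_trans[OF zero_le_one cube_sum_green_ge_1]
    by (intro summable_of_growth_rate_less)
  then have "summable (\<lambda>n. prob (E n))"
    by (rule summable_comparison_test') (use prob_E in simp)
  then have "AE \<omega> in M. \<forall>\<^sub>F n in sequentially. \<omega> \<in> space M - E n"
    by (intro borel_cantelli_AE1) (auto simp: emeasure_eq_measure)
  then show "AE \<omega> in M. upper_mink_dim (range_walk \<xi> \<omega>) \<le> ereal \<gamma>"
  proof eventually_elim
    case (elim \<omega>)
    then have "\<forall>\<^sub>F n in sequentially. range_count n \<omega> \<le> 1 * 2 powr (\<gamma> * real n)"
      by eventually_elim (auto simp: E_def)
    then show ?case
      unfolding upper_mink_dim_range_walk
      by (rule growth_rate_le_of_eventually_le[OF \<open>0 \<le> \<gamma>\<close>, rotated]) (simp add: range_count_def)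
  qed
qed

lemma frequently_prob_range_count_ge:
  assumes "0 \<le> \<gamma>" "ereal \<gamma> < growth_rate (cube_sum green)"
  shows "\<exists>\<^sub>F n in sequentially. 1 / (8 * 4 ^ CARD('d) * (green 0)\<^sup>2)
    \<le> prob {\<omega> \<in> space M. 2 powr (\<gamma> * real n) \<le> range_count n \<omega>}"
proof -
  have "\<exists>\<^sub>F n in sequentially. 2 * green 0 * 2 powr (\<gamma> * real n) \<le> cube_sum green n"
    using assms order_trans[OF zero_le_one cube_sum_green_ge_1]
    by (intro frequently_ge_of_less_growth_rate)
  then show ?thesis
  proof (rule frequently_mono[rotated], intro allI impI)
    fix n assume "2 * green 0 * 2 powr (\<gamma> * real n) \<le> cube_sum green n"
    then have "2 powr (\<gamma> * real n) \<le> cube_sum green n / (2 * green 0)"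
      using green_0_ge_1 by (simp add: field_simps)
    then have "prob {\<omega> \<in> space M. cube_sum green n / (2 * green 0) \<le> range_count n \<omega>}
        \<le> prob {\<omega> \<in> space M. 2 powr (\<gamma> * real n) \<le> range_count n \<omega>}"
      by (intro finite_measure_mono) auto
    with prob_range_count_ge show "1 / (8 * 4 ^ CARD('d) * (green 0)\<^sup>2)
        \<le> prob {\<omega> \<in> space M. 2 powr (\<gamma> * real n) \<le> range_count n \<omega>}"
      by (rule order_trans)
  qed
qed

lemma AE_dim_range_ge: "AE \<omega> in M. growth_rate (cube_sum green) \<le> upper_mink_dim (range_walk \<xi> \<omega>)"
proof (rule AE_ge_of_AE_ge_reals)
  fix \<gamma> assume less: "ereal \<gamma> < growth_rate (cube_sum green)"
  define E where "E n = {\<omega> \<in> space M. 2 powr (\<gamma> * real n) \<le> range_count n \<omega>}" for n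
  let ?D = "{\<omega> \<in> space M. ereal \<gamma> \<le> upper_mink_dim (range_walk \<xi> \<omega>)}"
  show "AE \<omega> in M. ereal \<gamma> \<le> upper_mink_dim (range_walk \<xi> \<omega>)"
  proof (cases "0 \<le> \<gamma>")
    case True
    have [measurable]: "E n \<in> sets M" for n unfolding E_def by measurable
    have "0 < 1 / (8 * 4 ^ CARD('d) * (green 0)\<^sup>2)"
      using green_0_ge_1 by simp
    also have "\<dots> \<le> prob (limsup E)"
      using frequently_prob_range_count_ge[OF True less]
      by (intro measure_limsup_ge) (simp_all add: E_def)
    also have "\<dots> \<le> prob ?D"
    proof (intro finite_measure_mono subsetI CollectI conjI)
      fix \<omega> assume "\<omega> \<in> limsup E"
      then have infinitely_often: "\<exists>n\<ge>m. \<omega> \<in> E n" for m by (auto simp: limsup_INF_SUP)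
      then show "\<omega> \<in> space M" by (auto simp: E_def)
      show "ereal \<gamma> \<le> upper_mink_dim (range_walk \<xi> \<omega>)"
        unfolding upper_mink_dim_range_walk
        using infinitely_often
        by (intro le_growth_rate_of_frequently_ge) (auto simp: frequently_sequentially E_def)
    qed measurable
    finally have "prob ?D = 1" using dim_range_zero_one[of "ereal \<gamma>"] by linarith
    then show ?thesis
      by (subst (asm) prob_Collect_eq_1) auto
  next
    case False
    then have "ereal \<gamma> \<le> upper_mink_dim (range_walk \<xi> \<omega>)" for \<omega>
      by (intro order_trans[OF _ upper_mink_dim_nonneg]) simp
    then show ?thesis by simp
  qed
qed

end

theorem theorem6p1:
  fixes M :: "'w measure" and \<xi> :: "nat \<Rightarrow> 'w \<Rightarrow> int ^ 'd"
  assumes "prob_space M"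
    and "\<And>i. \<xi> i \<in> measurable M (count_space UNIV)"
    and "prob_space.indep_vars M (\<lambda>_. count_space UNIV) \<xi> UNIV"
    and "\<And>i. distr M (count_space UNIV) (\<xi> i) = distr M (count_space UNIV) (\<xi> 0)"
    and transient: "\<And>x. green0 M \<xi> x < \<top>"
  shows "AE \<omega> in M. upper_mink_dim (range_walk \<xi> \<omega>) = ereal (gamma_c M \<xi>)"
proof -
  interpret prob_space M by fact
  interpret transient_random_walk M \<xi>
    by standard (fact assms)+
  from AE_dim_range_le AE_dim_range_ge show ?thesis
    unfolding gamma_c_eq_growth_rate by eventually_elim (rule antisym)
qed

end
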